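(* Let $k\ge 1$. An element $g\in B_k$ belongs to the commutator subgroup $B_k'$ if and only if $g$ has even index on $X^l$ for all $0\le l<k$.
   Context: $C_2=\langle\sigma\rangle$ with $\sigma=(1,2)$. For a group $B$, elements of $B\wr C_2$ are written $(g_1,g_2)\pi$ with $g_1,g_2\in B$ and $\pi\in C_2$, with multiplication $(g_1,g_2)\pi_g\cdot(h_1,h_2)\pi_h=(g_1h_{\pi_g(1)},g_2h_{\pi_g(2)})\pi_g\pi_h$. Define $B_1=C_2$ and $B_k=B_{k-1}\wr C_2$ for $k>1$. $B_k$ is identified with the automorphism group of the rooted binary tree $X^{[k]}$ with levels $X^0,\ldots,X^k$, where $|X^l|=2^l$. The vertex permutation of $g$ at a vertex $v\in X^l$ ($l<k$) is the permutation induced on the two children by the section of $g$ at $v$; the vertex is active if this permutation is nontrivial. Equivalently, for $g=(g_1,g_2)\sigma^i\in B_k$ with $i\in\{0,1\}$, the root is active iff $i=1$, and the activity of the vertices in the two subtrees below the root is given by $g_1$ and $g_2$ respectively. The index of $g$ on $X^l$ is the number of active vertices of $g$ on $X^l$. *)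

theory Defs
  imports "HOL-Algebra.Weak_Morphisms" "HOL-Algebra.Sym_Groups"
begin

definition sigma :: "nat \<Rightarrow> nat" where
  "sigma = transpose 1 2"

definition C2 :: "(nat \<Rightarrow> nat) monoid" where
  "C2 = subgroup_generated (sym_group 2) {sigma}"

fun coord :: "'a \<times> 'a \<Rightarrow> nat \<Rightarrow> 'a" where
  "coord (x1, x2) i = (if i = 1 then x1 else x2)"

text \<open>The wreath product of \<open>G\<close> with \<open>C2\<close>; the element written
  \<open>(g1, g2) p\<close> on paper is the pair \<open>((g1, g2), p)\<close>.\<close>

definition wreath_C2 :: "('a, 'b) monoid_scheme \<Rightarrow> (('a \<times> 'a) \<times> (nat \<Rightarrow> nat)) monoid" where
  "wreath_C2 G =
    \<lparr> carrier = (carrier G \<times> carrier G) \<times> carrier C2,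
      monoid.mult = (\<lambda>(g, p) (h, q).
        ((coord g 1 \<otimes>\<^bsub>G\<^esub> coord h (p 1), coord g 2 \<otimes>\<^bsub>G\<^esub> coord h (p 2)), p \<otimes>\<^bsub>C2\<^esub> q)),
      monoid.one = ((\<one>\<^bsub>G\<^esub>, \<one>\<^bsub>G\<^esub>), \<one>\<^bsub>C2\<^esub>) \<rparr>"

text \<open>The type of the elements of an iterated wreath product would grow with the number of
  iterations. The following datatype holds the elements of all of them: \<open>Wr g1 g2 p\<close> stands for
  \<open>((g1, g2), p)\<close>, and the injective constructors transport the group structure.\<close>

datatype elem = Base "nat \<Rightarrow> nat" | Wr elem elem "nat \<Rightarrow> nat"

text \<open>\<open>B 0\<close> is left unspecified.\<close>

fun B :: "nat \<Rightarrow> elem monoid" where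
  "B (Suc 0) = image_group Base C2"
| "B (Suc (Suc k)) = image_group (\<lambda>((g1, g2), p). Wr g1 g2 p) (wreath_C2 (B (Suc k)))"

text \<open>Vertices of the binary tree are words over \<open>{1, 2}\<close>, the root being the empty word.\<close>

definition level :: "nat \<Rightarrow> nat list set" where
  "level l = {v. length v = l \<and> set v \<subseteq> {1, 2}}"

fun root_perm :: "elem \<Rightarrow> nat \<Rightarrow> nat" where
  "root_perm (Base p) = p"
| "root_perm (Wr g1 g2 p) = p"

text \<open>For \<open>g\<close> in \<open>B k\<close> only sections at words of length less than \<open>k\<close> are meaningful; a \<open>Base\<close>
  element has no section at a nonempty word.\<close>

fun sect :: "elem \<Rightarrow> nat list \<Rightarrow> elem" where
  "sect g [] = g"
| "sect (Wr g1 g2 p) (x # v) = sect (coord (g1, g2) x) v"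

definition vertex_perm :: "elem \<Rightarrow> nat list \<Rightarrow> nat \<Rightarrow> nat" where
  "vertex_perm g v = root_perm (sect g v)"

definition active :: "elem \<Rightarrow> nat list \<Rightarrow> bool" where
  "active g v \<longleftrightarrow> vertex_perm g v \<noteq> id"

definition index_on :: "elem \<Rightarrow> nat \<Rightarrow> nat" where
  "index_on g l = card {v \<in> level l. active g v}"

text \<open>The remaining facts confirm that \<open>B k\<close> is a group, that it acts faithfully on the words of
  length at most \<open>k\<close>, and that \<open>vertex_perm\<close> is the permutation which this action induces on
  children. With the multiplication above it is a right action.\<close>

fun act :: "elem \<Rightarrow> nat list \<Rightarrow> nat list" where
  "act g [] = []"
| "act (Base p) (x # v) = p x # v"
| "act (Wr g1 g2 p) (x # v) = p x # act (coord (g1, g2) x) v"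

lemma sigma_simps [simp]: "sigma 1 = 2" "sigma (Suc 0) = 2" "sigma 2 = 1" "sigma \<noteq> id"
  and sigma_sigma [simp]: "sigma \<circ> sigma = id"
proof -
  show *: "sigma 1 = 2" "sigma (Suc 0) = 2" "sigma 2 = 1" by (auto simp: sigma_def)
  show "sigma \<noteq> id" using *(1) by (metis id_apply num.distinct(1) one_eq_numeral_iff)
  show "sigma \<circ> sigma = id" by (simp add: sigma_def)
qed

lemma C2_ops [simp]: "monoid.mult C2 = (\<circ>)" "monoid.one C2 = id"
  by (simp_all add: C2_def subgroup_generated_def sym_group_def)

lemma group_C2: "group C2"
  by (simp add: C2_def group.group_subgroup_generated sym_group_is_group)

lemma carrier_C2: "carrier C2 = {id, sigma}"
proof -
  have perm: "sigma \<in> carrier (sym_group 2)"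
    unfolding sym_group_def sigma_def by (auto intro!: permutes_swap_id)
  have sub: "subgroup {id, sigma} (sym_group 2)"
  proof (rule group.subgroupI[OF sym_group_is_group])
    show "{id, sigma} \<subseteq> carrier (sym_group 2)"
      using perm by (auto simp: sym_group_def)
    fix a assume a: "a \<in> {id, sigma}"
    then have "inv\<^bsub>sym_group 2\<^esub> a = a"
      using perm by (intro group.inv_equality[OF sym_group_is_group])
        (auto simp: sym_group_def)
    with a show "inv\<^bsub>sym_group 2\<^esub> a \<in> {id, sigma}" by simp
  qed (auto simp: sym_group_def)
  have "generate (sym_group 2) {sigma} \<subseteq> {id, sigma}"
    by (rule group.generate_subgroup_incl[OF sym_group_is_group _ sub]) auto
  moreover have "id \<in> generate (sym_group 2) {sigma}" "sigma \<in> generate (sym_group 2) {sigma}"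
    using generate.one[of "sym_group 2" "{sigma}"]
    by (auto simp: sym_group_def intro: generate.incl)
  ultimately show ?thesis
    using perm by (auto simp: C2_def carrier_subgroup_generated)
qed

lemma group_wreath_C2:
  fixes G (structure)
  assumes "group G" shows "group (wreath_C2 G)"
proof -
  interpret group G by fact
  show ?thesis
  proof (rule groupI)
    fix x assume "x \<in> carrier (wreath_C2 G)"
    then obtain a b p where x: "x = ((a, b), p)" "a \<in> carrier G" "b \<in> carrier G" "p \<in> {id, sigma}"
      by (auto simp: wreath_C2_def carrier_C2)
    show "\<exists>y\<in>carrier (wreath_C2 G). y \<otimes>\<^bsub>wreath_C2 G\<^esub> x = \<one>\<^bsub>wreath_C2 G\<^esub>"
    proof (cases "p = id")
      case True
      then show ?thesis using x
        by (intro bexI[of _ "((inv a, inv b), id)"]) (auto simp: wreath_C2_def carrier_C2)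
    next
      case False
      then show ?thesis using x
        by (intro bexI[of _ "((inv b, inv a), sigma)"]) (auto simp: wreath_C2_def carrier_C2)
    qed
  qed (auto simp: wreath_C2_def carrier_C2 m_assoc)
qed

lemma inj_Wr: "inj (\<lambda>((g1, g2), p). Wr g1 g2 p)"
  by (auto simp: inj_on_def)

lemma group_image_inj:
  assumes "group G" "inj f" shows "group (image_group f G)"
proof -
  have inv_f: "inv_into (carrier G) f (f a) = a" if "a \<in> carrier G" for a
    using that assms(2) by (simp add: inj_on_subset)
  interpret group G by fact
  show ?thesis
    by (rule groupI) (auto simp: image_group_def inv_f m_assoc intro!: bexI[of _ "m_inv G _"])
qed

lemma group_B: "group (B (Suc k))"
proof (induction k)
  case 0
  have "inj Base" by (auto simp: inj_on_def)
  then show ?case by (simp add: group_image_inj[OF group_C2])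
next
  case (Suc k)
  then show ?case using group_image_inj[OF group_wreath_C2 inj_Wr] by simp
qed

lemma carrier_B:
  "carrier (B (Suc 0)) = {Base p |p. p \<in> {id, sigma}}"
  "carrier (B (Suc (Suc k))) =
     {Wr a b p |a b p. a \<in> carrier (B (Suc k)) \<and> b \<in> carrier (B (Suc k)) \<and> p \<in> {id, sigma}}"
  by (auto simp: image_group_def wreath_C2_def carrier_C2 image_iff) blast+

lemma mult_B_Base:
  assumes "Base p \<in> carrier (B (Suc 0))" "Base q \<in> carrier (B (Suc 0))"
  shows "Base p \<otimes>\<^bsub>B (Suc 0)\<^esub> Base q = Base (p \<circ> q)"
proof -
  have "inv_into (carrier C2) Base (Base r) = r" if "Base r \<in> carrier (B (Suc 0))" for r
    using that by (intro inv_into_f_f) (auto simp: image_group_def inj_on_def)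
  with assms show ?thesis by (simp add: image_group_def)
qed

lemma mult_B_Wr:
  assumes "Wr g1 g2 p \<in> carrier (B (Suc (Suc k)))" "Wr h1 h2 q \<in> carrier (B (Suc (Suc k)))"
  shows "Wr g1 g2 p \<otimes>\<^bsub>B (Suc (Suc k))\<^esub> Wr h1 h2 q =
    Wr (g1 \<otimes>\<^bsub>B (Suc k)\<^esub> coord (h1, h2) (p 1)) (g2 \<otimes>\<^bsub>B (Suc k)\<^esub> coord (h1, h2) (p 2)) (p \<circ> q)"
proof -
  let ?f = "\<lambda>((g1, g2), p). Wr g1 g2 p"
  have "inv_into (carrier (wreath_C2 (B (Suc k)))) ?f (Wr a b r) = ((a, b), r)"
    if "Wr a b r \<in> carrier (B (Suc (Suc k)))" for a b r
    using that inv_into_f_f[of ?f "carrier (wreath_C2 (B (Suc k)))" "((a, b), r)"]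
    by (auto simp: image_group_def inj_on_subset[OF inj_Wr])
  with assms show ?thesis by (simp add: image_group_def wreath_C2_def del: coord.simps) simp
qed

lemma act_mult:
  assumes "g \<in> carrier (B (Suc k))" "h \<in> carrier (B (Suc k))" "set v \<subseteq> {1, 2}"
  shows "act (g \<otimes>\<^bsub>B (Suc k)\<^esub> h) v = act h (act g v)"
  using assms
proof (induction k arbitrary: g h v)
  case 0
  then obtain p q where "g = Base p" "h = Base q" "p \<in> {id, sigma}" "q \<in> {id, sigma}"
    unfolding carrier_B(1) by blast
  with 0 show ?case
    by (cases v) (auto simp: mult_B_Base carrier_B(1) simp del: B.simps)
next
  case (Suc k)
  from Suc.prems(1,2) obtain a b p c d q where
    eq: "g = Wr a b p" "h = Wr c d q" "p \<in> {id, sigma}" "q \<in> {id, sigma}"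
    and mem: "a \<in> carrier (B (Suc k))" "b \<in> carrier (B (Suc k))"
      "c \<in> carrier (B (Suc k))" "d \<in> carrier (B (Suc k))"
    unfolding carrier_B(2) by blast
  have prod: "g \<otimes>\<^bsub>B (Suc (Suc k))\<^esub> h =
    Wr (a \<otimes>\<^bsub>B (Suc k)\<^esub> coord (c, d) (p 1)) (b \<otimes>\<^bsub>B (Suc k)\<^esub> coord (c, d) (p 2)) (p \<circ> q)"
    using Suc.prems(1,2) unfolding eq(1,2) by (rule mult_B_Wr)
  show ?case
  proof (cases v)
    case (Cons x w)
    with Suc.prems(3) have "x = 1 \<or> x = 2" "set w \<subseteq> {1, 2}" by auto
    then show ?thesis
      using eq(3,4) mem Suc.IH[of _ _ w] unfolding prod
      by (auto simp: Cons eq(1,2) simp del: B.simps)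
  qed (use prod in \<open>simp del: B.simps\<close>)
qed

lemma act_inject:
  assumes "g \<in> carrier (B (Suc k))" "h \<in> carrier (B (Suc k))"
    and "\<And>v. v \<in> level (Suc k) \<Longrightarrow> act g v = act h v"
  shows "g = h"
  using assms
proof (induction k arbitrary: g h)
  case 0
  then obtain p q where *: "g = Base p" "h = Base q" "p \<in> {id, sigma}" "q \<in> {id, sigma}"
    unfolding carrier_B(1) by blast
  then have "p 1 = q 1" using "0.prems"(3)[of "[1]"] by (simp add: level_def)
  with * show ?case by auto
next
  case (Suc k)
  from Suc.prems(1,2) obtain a b p c d q where
    eq: "g = Wr a b p" "h = Wr c d q" "p \<in> {id, sigma}" "q \<in> {id, sigma}"
    and mem: "a \<in> carrier (B (Suc k))" "b \<in> carrier (B (Suc k))"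
      "c \<in> carrier (B (Suc k))" "d \<in> carrier (B (Suc k))"
    unfolding carrier_B(2) by blast
  have 1: "p 1 = q 1 \<and> act a v = act c v" and 2: "act b v = act d v" if "v \<in> level (Suc k)" for v
    using that Suc.prems(3)[of "1 # v"] Suc.prems(3)[of "2 # v"] by (auto simp: eq(1,2) level_def)
  have "replicate (Suc k) 1 \<in> level (Suc k)" by (auto simp: level_def)
  then have "p 1 = q 1" using 1 by blast
  then have "p = q" using eq(3,4) by auto
  moreover have "a = c" "b = d" using Suc.IH mem 1 2 by blast+
  ultimately show ?case by (simp add: eq(1,2))
qed

lemma act_append_child:
  assumes "g \<in> carrier (B (Suc k))" "length v \<le> k"
  shows "act g (v @ [x]) = act g v @ [vertex_perm g v x]"
  using assms
proof (induction v arbitrary: g k)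
  case Nil
  then show ?case by (cases g) (simp_all add: vertex_perm_def)
next
  case (Cons y v)
  then obtain m where m: "k = Suc m" by (cases k) auto
  with Cons.prems(1) obtain a b p where eq: "g = Wr a b p"
    and mem: "a \<in> carrier (B (Suc m))" "b \<in> carrier (B (Suc m))"
    unfolding m carrier_B(2) by blast
  show ?case
    using Cons.IH[of a m] Cons.IH[of b m] Cons.prems(2) mem m
    by (auto simp: eq vertex_perm_def simp del: B.simps)
qed

end

theory Submission
  imports Defs
begin

text \<open>On every level the parity of the index is a homomorphism, so it vanishes on commutators.
  Conversely, let all indices of \<open>g\<close> be even. Then \<open>g = (a, b)\<close> with inactive root, and
  \<open>(a, b) = (a, a\<inverse>) (1, a b)\<close>. Here \<open>(a, a\<inverse>)\<close> is the commutator of \<open>(a, 1)\<close> and \<open>\<sigma>\<close>,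
  and \<open>a b\<close>, having even indices, is by induction a product of commutators.\<close>

lemma index_on_0: "index_on g 0 = (if root_perm g = id then 0 else 1)"
proof -
  have "{v \<in> level 0. active g v} = (if root_perm g = id then {} else {[]})"
    by (auto simp: level_def active_def vertex_perm_def)
  then show ?thesis by (simp add: index_on_def)
qed

lemma finite_level: "finite (level l)"
  using finite_lists_length_eq[of "{1, 2::nat}" l] by (simp add: level_def conj_commute)

lemma index_on_Wr_Suc: "index_on (Wr a b p) (Suc l) = index_on a l + index_on b l"
proof -
  have "{v \<in> level (Suc l). active (Wr a b p) v} =
    Cons 1 ` {v \<in> level l. active a v} \<union> Cons 2 ` {v \<in> level l. active b v}"
    by (auto simp: level_def active_def vertex_perm_def length_Suc_conv)
  moreover have "card (Cons 1 ` {v \<in> level l. active a v} \<union> Cons 2 ` {v \<in> level l. active b v}) =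
    card {v \<in> level l. active a v} + card {v \<in> level l. active b v}"
    by (subst card_Un_disjoint) (auto simp: finite_level card_image)
  ultimately show ?thesis
    by (simp add: index_on_def)
qed

text \<open>In \<open>C2\<close> a product of two elements is nontrivial iff exactly one factor is,
  so activity adds modulo 2. The root permutation of \<open>g\<close> only moves the vertices at
  which \<open>h\<close> is read off, which does not affect the count on a whole level.\<close>

lemma even_index_on_mult:
  assumes "g \<in> carrier (B (Suc k))" "h \<in> carrier (B (Suc k))" "l \<le> k"
  shows "even (index_on (g \<otimes>\<^bsub>B (Suc k)\<^esub> h) l) \<longleftrightarrow>
    (even (index_on g l) \<longleftrightarrow> even (index_on h l))"
  using assms
proof (induction k arbitrary: g h l)
  case 0
  then obtain p q where "g = Base p" "h = Base q" "p \<in> {id, sigma}" "q \<in> {id, sigma}"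
    unfolding carrier_B(1) by blast
  with 0 show ?case
    by (auto simp: mult_B_Base carrier_B(1) index_on_0 simp del: B.simps)
next
  case (Suc k)
  from Suc.prems(1,2) obtain a b p c d q where
    eq: "g = Wr a b p" "h = Wr c d q" "p \<in> {id, sigma}" "q \<in> {id, sigma}"
    and mem: "a \<in> carrier (B (Suc k))" "b \<in> carrier (B (Suc k))"
      "c \<in> carrier (B (Suc k))" "d \<in> carrier (B (Suc k))"
    unfolding carrier_B(2) by blast
  have prod: "g \<otimes>\<^bsub>B (Suc (Suc k))\<^esub> h =
    Wr (a \<otimes>\<^bsub>B (Suc k)\<^esub> coord (c, d) (p 1)) (b \<otimes>\<^bsub>B (Suc k)\<^esub> coord (c, d) (p 2)) (p \<circ> q)"
    using Suc.prems(1,2) unfolding eq(1,2) by (rule mult_B_Wr)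
  show ?case
  proof (cases l)
    case 0
    then show ?thesis
      using eq(3,4) unfolding prod by (auto simp: eq(1,2) index_on_0 simp del: B.simps)
  next
    case (Suc m)
    with Suc.prems(3) have "m \<le> k" by simp
    \<comment> \<open>Whether \<open>p\<close> is \<open>id\<close> or \<open>sigma\<close>, each of
      \<open>c\<close> and \<open>d\<close> is multiplied to exactly one of \<open>a\<close> and
      \<open>b\<close>, so the sum of the two indices has the same parity in both cases.\<close>
    with eq(3) mem Suc.IH[of _ _ m] show ?thesis
      unfolding prod by (auto simp: eq(1,2) Suc index_on_Wr_Suc simp del: B.simps)
  qed
qed

lemma one_B_Suc: "\<one>\<^bsub>B (Suc (Suc k))\<^esub> = Wr \<one>\<^bsub>B (Suc k)\<^esub> \<one>\<^bsub>B (Suc k)\<^esub> id"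
  by (simp add: image_group_def wreath_C2_def)

lemma even_index_on_one:
  assumes "l \<le> k" shows "even (index_on \<one>\<^bsub>B (Suc k)\<^esub> l)"
proof -
  interpret group "B (Suc k)" by (rule group_B)
  \<comment> \<open>Since the unit is idempotent, its parity is twice itself modulo 2, hence
    even.\<close>
  show ?thesis using even_index_on_mult[OF one_closed one_closed assms]
    by (simp del: B.simps)
qed

lemma even_index_on_inv:
  assumes "g \<in> carrier (B (Suc k))" "l \<le> k"
  shows "even (index_on (inv\<^bsub>B (Suc k)\<^esub> g) l) \<longleftrightarrow> even (index_on g l)"
proof -
  interpret group "B (Suc k)" by (rule group_B)
  show ?thesis
    using even_index_on_mult[OF assms(1) inv_closed[OF assms(1)] assms(2)]
      even_index_on_one[OF assms(2)] r_inv[OF assms(1)]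
    by (simp del: B.simps)
qed

lemma even_index_on_derived:
  assumes "g \<in> derived (B (Suc k)) (carrier (B (Suc k)))" "l \<le> k"
  shows "even (index_on g l)"
proof -
  interpret group "B (Suc k)" by (rule group_B)
  let ?K = "{g \<in> carrier (B (Suc k)). even (index_on g l)}"
  note parity = even_index_on_mult[OF _ _ assms(2)] even_index_on_inv[OF _ assms(2)]
    even_index_on_one[OF assms(2)]
  have "subgroup ?K (B (Suc k))"
    by (rule subgroup.intro) (auto simp: parity simp del: B.simps)
  \<comment> \<open>In a commutator the parities of both entries occur twice, once through the
    inverse, and cancel.\<close>
  moreover have "derived_set (B (Suc k)) (carrier (B (Suc k))) \<subseteq> ?K"
    by (auto simp: parity simp del: B.simps)
  ultimately have "derived (B (Suc k)) (carrier (B (Suc k))) \<subseteq> ?K"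
    unfolding derived_def using generate_subgroup_incl by blast
  with assms(1) show ?thesis by blast
qed

text \<open>Embedding \<open>B (Suc k)\<close> as the second coordinate is a homomorphism, and
  homomorphisms map commutators to commutators. This lifts the induction hypothesis one level
  up.\<close>

lemma Wr_one_in_derived:
  assumes "x \<in> derived (B (Suc k)) (carrier (B (Suc k)))"
  shows "Wr \<one>\<^bsub>B (Suc k)\<^esub> x id \<in> derived (B (Suc (Suc k))) (carrier (B (Suc (Suc k))))"
proof -
  interpret G: group "B (Suc k)" by (rule group_B)
  interpret H: group "B (Suc (Suc k))" by (rule group_B)
  interpret group_hom "B (Suc k)" "B (Suc (Suc k))" "\<lambda>x. Wr \<one>\<^bsub>B (Suc k)\<^esub> x id"
    by unfold_locales
      (auto intro!: homI simp: carrier_B(2) mult_B_Wr simp del: B.simps)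
  have "Wr \<one>\<^bsub>B (Suc k)\<^esub> x id \<in>
    derived (B (Suc (Suc k))) ((\<lambda>x. Wr \<one>\<^bsub>B (Suc k)\<^esub> x id) ` carrier (B (Suc k)))"
    using assms derived_img[of "carrier (B (Suc k))"] by blast
  also have "\<dots> \<subseteq> derived (B (Suc (Suc k))) (carrier (B (Suc (Suc k))))"
    by (rule H.mono_derived) (use hom_closed in blast)+
  finally show ?thesis .
qed

lemma Wr_inv_in_derived:
  assumes a: "a \<in> carrier (B (Suc k))"
  shows "Wr a (inv\<^bsub>B (Suc k)\<^esub> a) id \<in> derived (B (Suc (Suc k))) (carrier (B (Suc (Suc k))))"
proof -
  interpret G: group "B (Suc k)" by (rule group_B)
  interpret H: group "B (Suc (Suc k))" by (rule group_B)
  let ?x = "Wr a \<one>\<^bsub>B (Suc k)\<^esub> id" and ?s = "Wr \<one>\<^bsub>B (Suc k)\<^esub> \<one>\<^bsub>B (Suc k)\<^esub> sigma"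
  let ?y = "Wr (inv\<^bsub>B (Suc k)\<^esub> a) \<one>\<^bsub>B (Suc k)\<^esub> id"
  have mem: "?x \<in> carrier (B (Suc (Suc k)))" "?s \<in> carrier (B (Suc (Suc k)))"
    "?y \<in> carrier (B (Suc (Suc k)))"
    using a by (auto simp: carrier_B(2) simp del: B.simps)
  have "inv\<^bsub>B (Suc (Suc k))\<^esub> ?x = ?y" "inv\<^bsub>B (Suc (Suc k))\<^esub> ?s = ?s"
    using mem a by (auto intro!: H.inv_equality simp: mult_B_Wr one_B_Suc simp del: B.simps)
  \<comment> \<open>As \<open>?s\<close> is an involution, the left side is the commutator of
    \<open>?x\<close> and \<open>?s\<close>. Conjugating \<open>?y\<close> by \<open>?s\<close>
    swaps its coordinates, which moves the inverse of \<open>a\<close> to the second place.\<close>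
  moreover have "?x \<otimes>\<^bsub>B (Suc (Suc k))\<^esub> ?s \<otimes>\<^bsub>B (Suc (Suc k))\<^esub> ?y \<otimes>\<^bsub>B (Suc (Suc k))\<^esub> ?s =
      Wr a (inv\<^bsub>B (Suc k)\<^esub> a) id"
    using a by (simp add: mult_B_Wr carrier_B(2) del: B.simps)
  ultimately have "Wr a (inv\<^bsub>B (Suc k)\<^esub> a) id \<in>
      derived_set (B (Suc (Suc k))) (carrier (B (Suc (Suc k))))"
    using mem(1,2) by (intro UN_I[of ?x] UN_I[of ?s]) (simp_all del: B.simps)
  then show ?thesis unfolding derived_def by (rule generate.incl)
qed

lemma in_derived_if_even_index_on:
  assumes "g \<in> carrier (B (Suc k))" "\<And>l. l \<le> k \<Longrightarrow> even (index_on g l)"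
  shows "g \<in> derived (B (Suc k)) (carrier (B (Suc k)))"
  using assms
proof (induction k arbitrary: g)
  case 0
  then have "g = Base id"
    using "0.prems"(2)[of 0] unfolding carrier_B(1) by (auto simp: index_on_0 split: if_splits)
  then have "g = \<one>\<^bsub>B (Suc 0)\<^esub>" by (simp add: image_group_def)
  then show ?case unfolding derived_def by (simp only: generate.one)
next
  case (Suc k)
  interpret G: group "B (Suc k)" by (rule group_B)
  interpret H: group "B (Suc (Suc k))" by (rule group_B)
  let ?D = "derived (B (Suc (Suc k))) (carrier (B (Suc (Suc k))))"
  from Suc.prems(1) obtain a b p where g: "g = Wr a b p"
    and mem: "a \<in> carrier (B (Suc k))" "b \<in> carrier (B (Suc k))"
    unfolding carrier_B(2) by blast
  \<comment> \<open>The only vertex on level 0 is the root, so an even index there must be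
    0.\<close>
  have p: "p = id"
    using Suc.prems(2)[of 0] by (simp add: g index_on_0 split: if_splits)
  \<comment> \<open>Single indices of \<open>a\<close> and \<open>b\<close> may be odd; only their
    sum, the index of \<open>g\<close> one level lower in the tree, is known to be even. Hence the
    induction hypothesis is applied to the product.\<close>
  have "even (index_on (a \<otimes>\<^bsub>B (Suc k)\<^esub> b) l)" if "l \<le> k" for l
    using Suc.prems(2)[of "Suc l"] that mem
    by (simp add: g index_on_Wr_Suc even_index_on_mult del: B.simps)
  then have "Wr \<one>\<^bsub>B (Suc k)\<^esub> (a \<otimes>\<^bsub>B (Suc k)\<^esub> b) id \<in> ?D"
    using mem by (intro Wr_one_in_derived Suc.IH) (simp_all del: B.simps)
  moreover have "g = Wr a (inv\<^bsub>B (Suc k)\<^esub> a) id \<otimes>\<^bsub>B (Suc (Suc k))\<^esub>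
      Wr \<one>\<^bsub>B (Suc k)\<^esub> (a \<otimes>\<^bsub>B (Suc k)\<^esub> b) id"
    using mem by (simp add: g p mult_B_Wr carrier_B(2) G.m_assoc[symmetric] del: B.simps)
  moreover have "Wr a (inv\<^bsub>B (Suc k)\<^esub> a) id \<in> ?D"
    using mem(1) by (rule Wr_inv_in_derived)
  ultimately show ?case
    unfolding derived_def by (simp only: generate.eng)
qed

theorem lemma8:
  fixes k :: nat and g :: elem
  assumes "k \<ge> 1" and "g \<in> carrier (B k)"
  shows "g \<in> derived (B k) (carrier (B k)) \<longleftrightarrow> (\<forall>l<k. even (index_on g l))"
proof -
  \<comment> \<open>\<open>B 0\<close> is unspecified, so the two directions are proved for
    \<open>B (Suc m)\<close>, where the levels \<open>l < k\<close> become
    \<open>l \<le> m\<close>.\<close>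
  obtain m where "k = Suc m" using assms(1) by (cases k) auto
  then show ?thesis
    using assms(2) even_index_on_derived in_derived_if_even_index_on
    by (auto simp: less_Suc_eq_le simp del: B.simps)
qed

end
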